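(* Let $E$ be an elliptic curve with complex multiplication by the ring $R=\operatorname{End}(E)$, let $\omega,\omega'\in R$, and let $\pi:E\to\mathbb{P}^1$ be the quotient map by the hyperelliptic involution. Let $\Delta=\{(P,P):P\in E\}\subsetneq E\times E$ and $\Delta'=\{(P,P):P\in\mathbb{P}^1\}\subsetneq\mathbb{P}^1\times\mathbb{P}^1$ be the diagonal subvarieties, so that $\Delta'=(\pi,\pi)(\Delta)$. Then $\Delta$ is pre-periodic for $[\omega]\times[\omega']:E\times E\to E\times E$ if and only if $\Delta'$ is pre-periodic for $\varphi_{[\omega]}\times\varphi_{[\omega']}:\mathbb{P}^1\times\mathbb{P}^1\to\mathbb{P}^1\times\mathbb{P}^1$.
   Context: The base field is algebraically closed of characteristic $0$; "complex multiplication" means that $R=\operatorname{End}(E)$ is strictly larger than $\mathbb{Z}$ (so $R$ is an order in an imaginary quadratic field). For $\omega\in R$, $[\omega]:E\to E$ denotes the corresponding endomorphism. The hyperelliptic involution is $P\mapsto -P$, and $\pi:E\to E/\{\pm1\}\cong\mathbb{P}^1$ is the quotient map. $\varphi_{[\omega]}:\mathbb{P}^1\to\mathbb{P}^1$ is the unique morphism with $\varphi_{[\omega]}\circ\pi=\pi\circ[\omega]$. The map $(\pi,\pi):E\times E\to\mathbb{P}^1\times\mathbb{P}^1$ is $(P,Q)\mapsto(\pi(P),\pi(Q))$, and $[\omega]\times[\omega']$ and $\varphi_{[\omega]}\times\varphi_{[\omega']}$ act coordinatewise. For a self-map $\varphi:X\to X$ of a projective variety, a subvariety $Y\subsetneq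 X$ is pre-periodic for $\varphi$ if there are integers $n\ge 0$ and $k>0$ with $\varphi^{n+k}(Y)=\varphi^{n}(Y)$, where $\varphi^m(Y)$ denotes the image of $Y$ under the $m$-th iterate of $\varphi$. *)

theory Defs
  imports "HOL-Analysis.Analysis" "HOL-Computational_Algebra.Computational_Algebra"
begin

section \<open>Regular maps between projective varieties\<close>

definition form :: "nat \<Rightarrow> ('a::field ^ 'n \<Rightarrow> 'a) \<Rightarrow> bool" where
  "form d F \<longleftrightarrow>
     (\<exists>c :: ('n \<Rightarrow> nat) \<Rightarrow> 'a. \<forall>v. F v =
        (\<Sum>m | (\<Sum>i\<in>UNIV. m i) = d. c m * (\<Prod>i\<in>UNIV. (v $ i) ^ m i)))"

text \<open>
  Points of a variety are the points rational over the (algebraically closed) base field.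
  A variety \<open>X\<close> in projective space is given by its set of points together with a choice \<open>h\<close>
  of a vector of homogeneous coordinates for each point; \<open>Y\<close> and \<open>k\<close> play the same role for
  the target.  A map is regular if near every point it is given by forms \<open>F i\<close> of a common
  degree.  The neighbourhood on which the \<open>F i\<close> have to describe the map is taken to be the whole
  open set on which they do not all vanish. This loses nothing: if they describe the map only on
  the part of a neighbourhood of \<open>P\<close> cut out by a form \<open>H\<close> with \<open>H (h P) \<noteq> 0\<close>, multiply every
  \<open>F i\<close> by \<open>H\<close>.
\<close>

definition regular_map ::
  "'p set \<Rightarrow> ('p \<Rightarrow> 'a::field ^ 'n) \<Rightarrow> 'q set \<Rightarrow> ('q \<Rightarrow> 'a ^ 'm) \<Rightarrow> ('p \<Rightarrow> 'q) \<Rightarrow> bool" where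
  "regular_map X h Y k f \<longleftrightarrow>
     f ` X \<subseteq> Y \<and>
     (\<forall>P\<in>X. \<exists>d. \<exists>F :: 'm \<Rightarrow> 'a ^ 'n \<Rightarrow> 'a.
        (\<forall>i. form d (F i)) \<and>
        (\<exists>i. F i (h P) \<noteq> 0) \<and>
        (\<forall>Q\<in>X. (\<exists>i. F i (h Q) \<noteq> 0) \<longrightarrow>
           (\<exists>c. c \<noteq> 0 \<and> (\<chi> i. F i (h Q)) = c *s k (f Q))))"

section \<open>Elliptic curves\<close>

text \<open>The equation \<open>y\<^sup>2 + a1 x y + a3 y = x\<^sup>3 + a2 x\<^sup>2 + a4 x + a6\<close>.\<close>

datatype 'a weierstrass = Weierstrass (a1: 'a) (a2: 'a) (a3: 'a) (a4: 'a) (a6: 'a)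

definition discriminant :: "'a::field weierstrass \<Rightarrow> 'a" where
  "discriminant E =
     (let b2 = (a1 E)^2 + 4 * a2 E;
          b4 = 2 * a4 E + a1 E * a3 E;
          b6 = (a3 E)^2 + 4 * a6 E;
          b8 = (a1 E)^2 * a6 E + 4 * a2 E * a6 E - a1 E * a3 E * a4 E
                 + a2 E * (a3 E)^2 - (a4 E)^2
      in - (b2^2) * b8 - 8 * b4^3 - 27 * b6^2 + 9 * b2 * b4 * b6)"

definition elliptic :: "'a::field weierstrass \<Rightarrow> bool" where
  "elliptic E \<longleftrightarrow> discriminant E \<noteq> 0"

datatype 'a ell_point = Infinity | Point 'a 'a

fun ell_coords :: "'a::field ell_point \<Rightarrow> 'a ^ 3" where
  "ell_coords Infinity = vector [0, 1, 0]"
| "ell_coords (Point x y) = vector [x, y, 1]"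

fun on_curve :: "'a::field weierstrass \<Rightarrow> 'a ell_point \<Rightarrow> bool" where
  "on_curve E Infinity \<longleftrightarrow> True"
| "on_curve E (Point x y) \<longleftrightarrow>
     y^2 + a1 E * x * y + a3 E * y = x^3 + a2 E * x^2 + a4 E * x + a6 E"

definition curve :: "'a::field weierstrass \<Rightarrow> 'a ell_point set" where
  "curve E = {P. on_curve E P}"

fun ell_neg :: "'a::field weierstrass \<Rightarrow> 'a ell_point \<Rightarrow> 'a ell_point" where
  "ell_neg E Infinity = Infinity"
| "ell_neg E (Point x y) = Point x (- y - a1 E * x - a3 E)"

text \<open>In the last equation \<open>l\<close> is the slope of the chord or of the tangent; note that two points
  of the curve with the same abscissa that are not opposite are equal.\<close>

fun ell_add :: "'a::field weierstrass \<Rightarrow> 'a ell_point \<Rightarrow> 'a ell_point \<Rightarrow> 'a ell_point" where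
  "ell_add E Infinity Q = Q"
| "ell_add E (Point x1 y1) Infinity = Point x1 y1"
| "ell_add E (Point x1 y1) (Point x2 y2) =
     (if x1 = x2 \<and> y1 = - y2 - a1 E * x2 - a3 E then Infinity
      else
        let l = (if x1 = x2
                 then (3 * x1^2 + 2 * a2 E * x1 + a4 E - a1 E * y1) / (2 * y1 + a1 E * x1 + a3 E)
                 else (y2 - y1) / (x2 - x1));
            x3 = l^2 + a1 E * l - a2 E - x1 - x2
        in ell_neg E (Point x3 (y1 + l * (x3 - x1))))"

definition ell_mult :: "'a::field weierstrass \<Rightarrow> int \<Rightarrow> 'a ell_point \<Rightarrow> 'a ell_point" where
  "ell_mult E n P =
     (let Q = (ell_add E P ^^ nat \<bar>n\<bar>) Infinity in if n \<ge> 0 then Q else ell_neg E Q)"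

text \<open>Endomorphisms of the algebraic group \<open>E\<close>, including the zero map. Only the restriction of
  such a function to \<open>curve E\<close> is meaningful.\<close>

definition End :: "'a::field weierstrass \<Rightarrow> ('a ell_point \<Rightarrow> 'a ell_point) set" where
  "End E = {f. regular_map (curve E) ell_coords (curve E) ell_coords f \<and>
     (\<forall>P\<in>curve E. \<forall>Q\<in>curve E. f (ell_add E P Q) = ell_add E (f P) (f Q))}"

definition complex_mult :: "'a::field weierstrass \<Rightarrow> bool" where
  "complex_mult E \<longleftrightarrow>
     (\<exists>\<omega>\<in>End E. \<forall>n. \<exists>P\<in>curve E. \<omega> P \<noteq> ell_mult E n P)"

section \<open>The quotient by the hyperelliptic involution\<close>

datatype 'a proj_line = PInf | Aff 'a

fun proj_coords :: "'a::field proj_line \<Rightarrow> 'a ^ 2" where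
  "proj_coords PInf = vector [1, 0]"
| "proj_coords (Aff x) = vector [x, 1]"

text \<open>The quotient map \<open>E \<rightarrow> E / {\<plusminus>1}\<close>, with the quotient identified with the projective line by the
  abscissa. The two lemmas following it confirm that it is onto and identifies exactly the
  pairs of opposite points.\<close>

fun ell_quot :: "'a ell_point \<Rightarrow> 'a proj_line" where
  "ell_quot Infinity = PInf"
| "ell_quot (Point x y) = Aff x"

lemma ell_quot_eq_iff:
  assumes "P \<in> curve E" "Q \<in> curve E"
  shows "ell_quot P = ell_quot Q \<longleftrightarrow> P = Q \<or> P = ell_neg E Q"
proof (cases P; cases Q)
  fix x y u v assume PQ: "P = Point x y" "Q = Point u v"
  have "y = v \<or> y = - v - a1 E * x - a3 E" if "x = u"
  proof -
    have "(y - v) * (y + v + a1 E * x + a3 E) = 0"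
    proof -
      have "y^2 + a1 E * x * y + a3 E * y = v^2 + a1 E * x * v + a3 E * v"
        using assms PQ that by (simp add: curve_def)
      then show ?thesis by algebra
    qed
    moreover have "y = - v - a1 E * x - a3 E" if "y + v + a1 E * x + a3 E = 0"
      using that by algebra
    ultimately show ?thesis by auto
  qed
  then show ?thesis using PQ by auto
qed auto

lemma ell_quot_surj:
  fixes E :: "'a::alg_closed_field weierstrass"
  shows "ell_quot ` curve E = UNIV"
proof -
  have "\<exists>P\<in>curve E. ell_quot P = Aff x" for x
  proof -
    define p where "p = [:- (x^3 + a2 E * x^2 + a4 E * x + a6 E), a1 E * x + a3 E, 1:]"
    have "degree p > 0" by (simp add: p_def)
    then obtain y where "poly p y = 0" using alg_closed_imp_poly_has_root by blast
    then have "Point x y \<in> curve E"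
      by (simp add: p_def curve_def power2_eq_square algebra_simps)
    then show ?thesis by (intro bexI[of _ "Point x y"]) auto
  qed
  moreover have "\<exists>P\<in>curve E. ell_quot P = PInf"
    by (intro bexI[of _ Infinity]) (auto simp: curve_def)
  ultimately have "\<exists>P\<in>curve E. ell_quot P = z" for z by (cases z) auto
  then show ?thesis by (metis UNIV_eq_I image_eqI)
qed

definition induced_map ::
  "'a::field weierstrass \<Rightarrow> ('a ell_point \<Rightarrow> 'a ell_point) \<Rightarrow> ('a proj_line \<Rightarrow> 'a proj_line) \<Rightarrow> bool"
where
  "induced_map E \<omega> \<phi> \<longleftrightarrow>
     regular_map UNIV proj_coords UNIV proj_coords \<phi> \<and>
     (\<forall>P\<in>curve E. \<phi> (ell_quot P) = ell_quot (\<omega> P))"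

lemma induced_map_unique:
  fixes E :: "'a::alg_closed_field weierstrass"
  assumes "induced_map E \<omega> \<phi>" "induced_map E \<omega> \<psi>"
  shows "\<phi> = \<psi>"
proof
  fix z
  obtain P where "P \<in> curve E" "z = ell_quot P" using ell_quot_surj[of E] by (metis UNIV_I imageE)
  then show "\<phi> z = \<psi> z" using assms by (simp add: induced_map_def)
qed

section \<open>Pre-periodic subvarieties\<close>

text \<open>To be applied to a subvariety \<open>Y\<close> of \<open>X\<close> and a morphism \<open>\<phi>\<close>. Morphisms of projective varieties
  are closed, so over an algebraically closed field images can be taken on points.\<close>

definition preperiodic :: "'p set \<Rightarrow> ('p \<Rightarrow> 'p) \<Rightarrow> 'p set \<Rightarrow> bool" where
  "preperiodic X \<phi> Y \<longleftrightarrow>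
     \<phi> ` X \<subseteq> X \<and> Y \<subset> X \<and> (\<exists>n k. k > 0 \<and> (\<phi> ^^ (n + k)) ` Y = (\<phi> ^^ n) ` Y)"

end

theory Submission
  imports Defs
begin

text \<open>
  Let \<open>A n\<close> be the image of the diagonal of \<open>E \<times> E\<close> under the \<open>n\<close>-th iterate of
  \<open>[\<omega>] \<times> [\<omega>']\<close>, that is, the set of all \<open>([\<omega>]\<^sup>n P, [\<omega>']\<^sup>n P)\<close>, and let \<open>B n\<close> be the set of all
  \<open>([\<omega>]\<^sup>n P, - [\<omega>']\<^sup>n P)\<close>; both are subgroups of \<open>E \<times> E\<close>.  Since \<open>(\<pi>, \<pi>)\<close> intertwines the two
  dynamical systems, \<open>A n\<close> is mapped onto the \<open>n\<close>-th image of the diagonal of the product of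
  projective lines, so that pre-periodicity descends at once.

  Conversely, suppose that \<open>A (n + k)\<close> and \<open>A n\<close> have the same image under \<open>(\<pi>, \<pi>)\<close>.  The fibres of
  \<open>\<pi>\<close> are pairs of opposite points, so \<open>A (n + k) \<subseteq> A n \<union> B n\<close>, and since a group
  contained in the union of two subgroups is contained in one of them (\<open>pair_image_subset_Un\<close>),
  \<open>A (n + k)\<close> is contained in \<open>A n\<close> or in \<open>B n\<close>; and likewise with \<open>n\<close> and \<open>n + k\<close>
  exchanged.  As the map \<open>(P, Q) \<mapsto> (P, - Q)\<close>
  is an involution that exchanges \<open>A\<close> and \<open>B\<close>, it follows that \<open>A (n + k) = A n\<close> or
  \<open>A (n + k) = B n\<close>.  In the second case applying \<open>[\<omega>]\<^sup>k \<times> [\<omega>']\<^sup>k\<close> once more gives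
  \<open>A (n + 2 k) = B (n + k) = A n\<close> (\<open>pair_image_funpow_periodic\<close>).

  Associativity of the addition on \<open>E\<close> is not needed for this: the argument about unions
  of subgroups works with the weaker law \<open>- P + (P + Q) = Q\<close>
  (\<open>ell_add_neg_cancel\<close>), which says only that the relation of lying on a common line is
  symmetric in three points of a nonsingular cubic.
\<close>

section \<open>The addition on an elliptic curve\<close>

lemma infinity_in_curve [simp]: "Infinity \<in> curve E"
  by (simp add: curve_def)

lemma ell_neg_in_curve: "P \<in> curve E \<Longrightarrow> ell_neg E P \<in> curve E"
proof (cases P)
  fix x y assume "P \<in> curve E" and P: "P = Point x y"
  then have "y^2 + a1 E * x * y + a3 E * y = x^3 + a2 E * x^2 + a4 E * x + a6 E"
    by (simp add: curve_def)
  then have "(- y - a1 E * x - a3 E)^2 + a1 E * x * (- y - a1 E * x - a3 E)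
      + a3 E * (- y - a1 E * x - a3 E) = x^3 + a2 E * x^2 + a4 E * x + a6 E"
    by algebra
  then show ?thesis by (simp add: P curve_def)
qed simp

lemma ell_neg_neg [simp]: "ell_neg E (ell_neg E P) = P"
  by (cases P) auto

lemma ell_add_infinity_right [simp]: "ell_add E P Infinity = P"
  by (cases P) auto

lemma ell_add_neg_left [simp]: "ell_add E (ell_neg E P) P = Infinity"
  by (cases P) auto

lemma ell_add_eq_infinity: "ell_add E P Q = Infinity \<Longrightarrow> P = ell_neg E Q"
  by (cases P; cases Q) (auto simp: Let_def split: if_splits)

text \<open>The two expressions are, up to sign, the partial derivatives of the Weierstrass equation.  If
  both vanish at a point of the curve, then \<open>a3\<close>, \<open>a4\<close> and \<open>a6\<close> are determined by \<open>a1\<close>, \<open>a2\<close> and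
  the point, and the discriminant is identically \<open>0\<close> on substituting them.\<close>

lemma elliptic_nonsingular:
  assumes "elliptic E" and "Point x y \<in> curve E" and "2 * y + a1 E * x + a3 E = 0"
  shows "3 * x^2 + 2 * a2 E * x + a4 E - a1 E * y \<noteq> 0"
proof
  assume "3 * x^2 + 2 * a2 E * x + a4 E - a1 E * y = 0"
  then have a4: "a4 E = a1 E * y - 3 * x^2 - 2 * a2 E * x" by algebra
  have a3: "a3 E = - 2 * y - a1 E * x" using assms(3) by algebra
  have "y^2 + a1 E * x * y + a3 E * y = x^3 + a2 E * x^2 + a4 E * x + a6 E"
    using assms by (simp add: curve_def)
  then have a6: "a6 E = y^2 + a1 E * x * y + a3 E * y - (x^3 + a2 E * x^2 + a4 E * x)"
    by algebra
  have "discriminant E = 0"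
    unfolding discriminant_def Let_def a6 a4 a3 by algebra
  then show False using assms by (simp add: elliptic_def)
qed

text \<open>
  The line \<open>y = l x + n\<close> meets the curve in points with abscissae \<open>x1\<close>, \<open>x2\<close>, \<open>x3\<close>, counted with
  multiplicity.  The equations compare the coefficients in
  \<open>x\<^sup>3 + a2 x\<^sup>2 + a4 x + a6 - (m\<^sup>2 + a1 x m + a3 m) = (x - x1) (x - x2) (x - x3)\<close>, where
  \<open>m = l x + n\<close>, and thus are symmetric in the three abscissae.
\<close>

definition line_section :: "'a::field weierstrass \<Rightarrow> 'a \<Rightarrow> 'a \<Rightarrow> 'a \<Rightarrow> 'a \<Rightarrow> 'a \<Rightarrow> bool" where
  "line_section E l n x1 x2 x3 \<longleftrightarrow>
     x1 + x2 + x3 = l^2 + a1 E * l - a2 E \<and>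
     x1 * x2 + x1 * x3 + x2 * x3 = a4 E - 2 * l * n - a1 E * n - a3 E * l \<and>
     x1 * x2 * x3 = n^2 + a3 E * n - a6 E"

lemma line_section_swap: "line_section E l n x1 x2 x3 \<Longrightarrow> line_section E l n x1 x3 x2"
  by (auto simp: line_section_def algebra_simps)

lemma line_section_third_in_curve:
  assumes "line_section E l n x1 x2 x3"
  shows "Point x3 (l * x3 + n) \<in> curve E"
proof -
  have "(l * x3 + n)^2 + a1 E * x3 * (l * x3 + n) + a3 E * (l * x3 + n)
      = x3^3 + a2 E * x3^2 + a4 E * x3 + a6 E"
    using assms unfolding line_section_def by algebra
  then show ?thesis by (simp add: curve_def)
qed

lemma ell_add_line_section:
  assumes "elliptic E" and sec: "line_section E l n x1 x2 x3"
  shows "ell_add E (Point x1 (l * x1 + n)) (Point x2 (l * x2 + n))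
           = ell_neg E (Point x3 (l * x3 + n))"
proof -
  have x3: "x3 = l^2 + a1 E * l - a2 E - x1 - x2"
    using sec unfolding line_section_def by algebra
  show ?thesis
  proof (cases "x1 = x2")
    case False
    have slope: "((l * x2 + n) - (l * x1 + n)) / (x2 - x1) = l"
      using False by (simp add: field_simps)
    have "l * x1 + n + l * (x3 - x1) = l * x3 + n"
      by (simp add: algebra_simps)
    then show ?thesis
      by (simp only: ell_add.simps Let_def False if_False simp_thms slope x3[symmetric])
  next
    case True
    define y where "y = l * x1 + n"
    have x2: "x2 = x1" using True by simp
    \<comment> \<open>The line is tangent to the curve, for the derivative of the cubic vanishes at a double root.\<close>
    have tangent: "l * (2 * y + a1 E * x1 + a3 E) = 3 * x1^2 + 2 * a2 E * x1 + a4 E - a1 E * y"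
      using sec True unfolding line_section_def y_def by algebra
    have "Point x1 y \<in> curve E"
      using line_section_third_in_curve[of E l n x3 x2 x1] sec
      by (simp add: line_section_def y_def algebra_simps)
    then have nz: "2 * y + a1 E * x1 + a3 E \<noteq> 0"
      using elliptic_nonsingular[OF assms(1)] tangent by force
    then have ne: "y \<noteq> - y - a1 E * x1 - a3 E" by algebra
    have slope: "(3 * x1^2 + 2 * a2 E * x1 + a4 E - a1 E * y) / (2 * y + a1 E * x1 + a3 E) = l"
      using nz tangent by (simp add: field_simps)
    have "y + l * (x3 - x1) = l * x3 + n"
      by (simp add: y_def algebra_simps)
    then show ?thesis
      by (simp only: ell_add.simps Let_def x2 ne if_True if_False simp_thms slope
          x3[unfolded x2, symmetric] y_def[symmetric])
  qed
qed

text \<open>The line in question is the chord, or the tangent if the two points coincide.  The tangent has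
  finite slope because the point then differs from its opposite.\<close>

lemma line_section_exists:
  assumes P: "Point x1 y1 \<in> curve E" and Q: "Point x2 y2 \<in> curve E"
    and ne: "Point x1 y1 \<noteq> ell_neg E (Point x2 y2)"
  shows "\<exists>l n x3. line_section E l n x1 x2 x3 \<and> y1 = l * x1 + n \<and> y2 = l * x2 + n"
proof -
  have eq1: "y1^2 + a1 E * x1 * y1 + a3 E * y1 = x1^3 + a2 E * x1^2 + a4 E * x1 + a6 E"
    and eq2: "y2^2 + a1 E * x2 * y2 + a3 E * y2 = x2^3 + a2 E * x2^2 + a4 E * x2 + a6 E"
    using P Q by (auto simp: curve_def)
  show ?thesis
  proof (cases "x1 = x2")
    case True
    have y: "y1 = y2"
      using ell_quot_eq_iff[OF P Q] ne True by auto
    define D where "D = 2 * y1 + a1 E * x1 + a3 E"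
    define l where "l = (3 * x1^2 + 2 * a2 E * x1 + a4 E - a1 E * y1) / D"
    define n where "n = y1 - l * x1"
    define x3 where "x3 = l^2 + a1 E * l - a2 E - x1 - x2"
    have "y1 \<noteq> - y1 - a1 E * x1 - a3 E" using ne True y by simp
    then have "D \<noteq> 0" unfolding D_def by algebra
    then have slope: "l * (2 * y1 + a1 E * x1 + a3 E)
        = 3 * x1^2 + 2 * a2 E * x1 + a4 E - a1 E * y1"
      by (simp add: l_def flip: D_def)
    have c2: "x1 * x2 + x1 * x3 + x2 * x3 = a4 E - 2 * l * n - a1 E * n - a3 E * l"
      using slope unfolding x3_def n_def True[symmetric] by algebra
    have c3: "x1 * x2 * x3 = n^2 + a3 E * n - a6 E"
      using c2 eq1 unfolding x3_def n_def True[symmetric] by algebra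
    have "line_section E l n x1 x2 x3"
      using c2 c3 by (simp add: line_section_def x3_def)
    moreover have "y1 = l * x1 + n" "y2 = l * x2 + n"
      using True y by (auto simp: n_def)
    ultimately show ?thesis by blast
  next
    case False
    define l where "l = (y2 - y1) / (x2 - x1)"
    define n where "n = y1 - l * x1"
    define x3 where "x3 = l^2 + a1 E * l - a2 E - x1 - x2"
    have "l * (x2 - x1) = y2 - y1" using False by (simp add: l_def)
    then have y: "y1 = l * x1 + n" "y2 = l * x2 + n"
      by (auto simp: n_def algebra_simps)
    have "(x1 - x2) * (x1 * x2 + x1 * x3 + x2 * x3 - (a4 E - 2 * l * n - a1 E * n - a3 E * l)) = 0"
      using eq1 eq2 unfolding x3_def y by algebra
    then have c2: "x1 * x2 + x1 * x3 + x2 * x3 = a4 E - 2 * l * n - a1 E * n - a3 E * l"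
      using False by simp
    have c3: "x1 * x2 * x3 = n^2 + a3 E * n - a6 E"
      using c2 eq1 unfolding x3_def y by algebra
    have "line_section E l n x1 x2 x3"
      using c2 c3 by (simp add: line_section_def x3_def)
    then show ?thesis using y by blast
  qed
qed

lemma line_section_cases [consumes 2, case_names degenerate line]:
  assumes "P \<in> curve E" "Q \<in> curve E"
  obtains "P = Infinity \<or> Q = Infinity \<or> P = ell_neg E Q"
    | l n x1 x2 x3 where "line_section E l n x1 x2 x3"
        "P = Point x1 (l * x1 + n)" "Q = Point x2 (l * x2 + n)"
proof (cases "P = Infinity \<or> Q = Infinity \<or> P = ell_neg E Q")
  case False
  then obtain x1 y1 x2 y2 where PQ: "P = Point x1 y1" "Q = Point x2 y2"
    by (cases P; cases Q) auto
  then have "\<exists>l n x3. line_section E l n x1 x2 x3 \<and> y1 = l * x1 + n \<and> y2 = l * x2 + n"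
    using False assms by (intro line_section_exists) auto
  then show ?thesis using that(2) PQ by blast
qed (use that(1) in blast)

lemma ell_add_in_curve:
  assumes "elliptic E" and P: "P \<in> curve E" and Q: "Q \<in> curve E"
  shows "ell_add E P Q \<in> curve E"
using P Q
proof (cases rule: line_section_cases)
  case degenerate
  then show ?thesis using P Q by auto
next
  case (line l n x1 x2 x3)
  note sec = line(1) and PQ = line(2,3)
  show ?thesis
    using ell_add_line_section[OF assms(1) sec] line_section_third_in_curve[OF sec]
    by (simp only: PQ ell_neg_in_curve)
qed

lemma ell_add_commute:
  assumes P: "P \<in> curve E" and Q: "Q \<in> curve E" and "elliptic E"
  shows "ell_add E P Q = ell_add E Q P"
using P Q
proof (cases rule: line_section_cases)
  case degenerate
  then show ?thesis by (metis ell_add.simps(1) ell_add_infinity_right ell_add_neg_left ell_neg_neg)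
next
  case (line l n x1 x2 x3)
  note sec = line(1) and PQ = line(2,3)
  have "line_section E l n x2 x1 x3"
    using sec by (auto simp: line_section_def algebra_simps)
  then show ?thesis
    using ell_add_line_section[OF assms(3)] sec unfolding PQ by metis
qed

text \<open>Negation maps the line \<open>y = l x + n\<close> to \<open>y = (- l - a1) x - n - a3\<close>.\<close>

lemma ell_neg_add:
  assumes "elliptic E" and P: "P \<in> curve E" and Q: "Q \<in> curve E"
  shows "ell_neg E (ell_add E P Q) = ell_add E (ell_neg E P) (ell_neg E Q)"
using P Q
proof (cases rule: line_section_cases)
  case degenerate
  then show ?thesis
    by (metis ell_add.simps(1) ell_add_infinity_right ell_add_neg_left ell_neg.simps(1))
next
  case (line l n x1 x2 x3)
  note sec = line(1) and PQ = line(2,3)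
  have neg: "ell_neg E (Point x (l * x + n)) = Point x ((- l - a1 E) * x + (- n - a3 E))" for x
    by (simp add: algebra_simps)
  have "line_section E (- l - a1 E) (- n - a3 E) x1 x2 x3"
    using sec unfolding line_section_def by algebra
  then show ?thesis
    using ell_add_line_section[OF assms(1)] sec unfolding PQ by (metis neg)
qed

text \<open>The only consequence of associativity that is used.  If \<open>P\<close>, \<open>Q\<close>, \<open>R\<close> are the points of
  a line section, then \<open>P + Q = - R\<close> and \<open>P + R = - Q\<close>.\<close>

lemma ell_add_neg_cancel:
  assumes "elliptic E" and P: "P \<in> curve E" and Q: "Q \<in> curve E"
  shows "ell_add E (ell_neg E P) (ell_add E P Q) = Q"
using P Q
proof (cases rule: line_section_cases)
  case degenerate
  then show ?thesis
    by (metis ell_add.simps(1) ell_add_infinity_right ell_add_neg_left ell_neg.simps(1) ell_neg_neg)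
next
  case (line l n x1 x2 x3)
  note sec = line(1) and PQ = line(2,3)
  define R where "R = Point x3 (l * x3 + n)"
  have "R \<in> curve E" using line_section_third_in_curve[OF sec] by (simp add: R_def)
  have "ell_add E P Q = ell_neg E R"
    using ell_add_line_section[OF assms(1) sec] by (simp only: PQ R_def)
  moreover have "ell_add E P R = ell_neg E Q"
    using ell_add_line_section[OF assms(1) line_section_swap[OF sec]] by (simp only: PQ R_def)
  ultimately show ?thesis
    using ell_neg_add[OF assms(1) P \<open>R \<in> curve E\<close>] by simp
qed

section \<open>Homomorphisms and their graphs\<close>

text \<open>Endomorphisms of the group of points, without the condition of being regular.  Values outside
  the curve do not matter.\<close>

definition ell_hom :: "'a::field weierstrass \<Rightarrow> ('a ell_point \<Rightarrow> 'a ell_point) \<Rightarrow> bool" where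
  "ell_hom E f \<longleftrightarrow> f ` curve E \<subseteq> curve E \<and>
     (\<forall>P\<in>curve E. \<forall>Q\<in>curve E. f (ell_add E P Q) = ell_add E (f P) (f Q))"

lemma ell_hom_in_curve: "ell_hom E f \<Longrightarrow> P \<in> curve E \<Longrightarrow> f P \<in> curve E"
  by (auto simp: ell_hom_def)

lemma ell_hom_add:
  "ell_hom E f \<Longrightarrow> P \<in> curve E \<Longrightarrow> Q \<in> curve E \<Longrightarrow> f (ell_add E P Q) = ell_add E (f P) (f Q)"
  by (auto simp: ell_hom_def)

lemma End_imp_ell_hom: "f \<in> End E \<Longrightarrow> ell_hom E f"
  by (auto simp: End_def ell_hom_def regular_map_def)

lemma ell_hom_neg: "elliptic E \<Longrightarrow> ell_hom E (ell_neg E)"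
  by (auto simp: ell_hom_def ell_neg_in_curve ell_neg_add)

lemma ell_hom_comp: "ell_hom E f \<Longrightarrow> ell_hom E g \<Longrightarrow> ell_hom E (f \<circ> g)"
  by (auto simp: ell_hom_def image_subset_iff)

lemma ell_hom_funpow: "ell_hom E f \<Longrightarrow> ell_hom E (f ^^ n)"
proof (induction n)
  case 0
  show ?case by (auto simp: ell_hom_def)
next
  case (Suc n)
  then show ?case unfolding funpow.simps by (intro ell_hom_comp) auto
qed

lemma ell_hom_ell_neg:
  assumes "elliptic E" and f: "ell_hom E f" and P: "P \<in> curve E"
  shows "f (ell_neg E P) = ell_neg E (f P)"
proof -
  have "f Infinity = ell_add E (f Infinity) (f Infinity)"
    using ell_hom_add[OF f, of Infinity Infinity] by simp
  then have "f Infinity = Infinity"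
    by (metis ell_add_neg_cancel[OF assms(1)] ell_add_neg_left ell_hom_in_curve[OF f]
        infinity_in_curve)
  then have "ell_add E (f (ell_neg E P)) (f P) = Infinity"
    using ell_hom_add[OF f, of "ell_neg E P" P] P by (simp add: ell_neg_in_curve)
  then show ?thesis by (rule ell_add_eq_infinity)
qed

text \<open>The subgroup of \<open>E \<times> E\<close> that is the image of \<open>E\<close> under \<open>P \<mapsto> (f P, g P)\<close>, when \<open>f\<close> and \<open>g\<close> are
  homomorphisms.\<close>

definition pair_image ::
  "'a::field weierstrass \<Rightarrow> ('a ell_point \<Rightarrow> 'a ell_point) \<Rightarrow> ('a ell_point \<Rightarrow> 'a ell_point)
     \<Rightarrow> ('a ell_point \<times> 'a ell_point) set" where
  "pair_image E f g = (\<lambda>P. (f P, g P)) ` curve E"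

lemma pair_image_subset: "ell_hom E f \<Longrightarrow> ell_hom E g \<Longrightarrow> pair_image E f g \<subseteq> curve E \<times> curve E"
  by (auto simp: pair_image_def ell_hom_in_curve)

lemma pair_image_add:
  assumes "elliptic E" "ell_hom E f" "ell_hom E g"
    and "(P, Q) \<in> pair_image E f g" "(P', Q') \<in> pair_image E f g"
  shows "(ell_add E P P', ell_add E Q Q') \<in> pair_image E f g"
proof -
  obtain U V where "U \<in> curve E" "V \<in> curve E" "P = f U" "Q = g U" "P' = f V" "Q' = g V"
    using assms by (auto simp: pair_image_def)
  then show ?thesis
    using assms by (auto simp: pair_image_def ell_add_in_curve simp flip: ell_hom_add)
qed

lemma pair_image_neg:
  assumes "elliptic E" "ell_hom E f" "ell_hom E g" and "(P, Q) \<in> pair_image E f g"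
  shows "(ell_neg E P, ell_neg E Q) \<in> pair_image E f g"
proof -
  obtain U where "U \<in> curve E" "P = f U" "Q = g U"
    using assms by (auto simp: pair_image_def)
  then show ?thesis
    using assms by (auto simp: pair_image_def ell_neg_in_curve simp flip: ell_hom_ell_neg)
qed

lemma pair_image_diff:
  assumes E: "elliptic E" and hom: "ell_hom E f" "ell_hom E g"
    and PQ: "(P, Q) \<in> pair_image E f g"
    and sum: "(ell_add E P P', ell_add E Q Q') \<in> pair_image E f g"
    and "P' \<in> curve E" "Q' \<in> curve E"
  shows "(P', Q') \<in> pair_image E f g"
proof -
  have "P \<in> curve E" "Q \<in> curve E" using pair_image_subset[OF hom] PQ by auto
  then show ?thesis
    using pair_image_add[OF E hom pair_image_neg[OF E hom PQ] sum] assms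
    by (simp add: ell_add_neg_cancel)
qed

text \<open>A group contained in the union of two subgroups is contained in one of them.\<close>

lemma pair_image_subset_Un:
  assumes E: "elliptic E" and hom: "ell_hom E f" "ell_hom E g"
    and hom1: "ell_hom E f1" "ell_hom E g1" and hom2: "ell_hom E f2" "ell_hom E g2"
    and sub: "pair_image E f g \<subseteq> pair_image E f1 g1 \<union> pair_image E f2 g2"
  shows "pair_image E f g \<subseteq> pair_image E f1 g1 \<or> pair_image E f g \<subseteq> pair_image E f2 g2"
proof (rule ccontr)
  assume "\<not> ?thesis"
  then obtain P Q P' Q' where
    P: "(P, Q) \<in> pair_image E f g" "(P, Q) \<notin> pair_image E f1 g1" and
    P': "(P', Q') \<in> pair_image E f g" "(P', Q') \<notin> pair_image E f2 g2"
    by auto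
  have curve: "P \<in> curve E" "Q \<in> curve E" "P' \<in> curve E" "Q' \<in> curve E"
    using pair_image_subset[OF hom] P P' by auto
  have in2: "(P, Q) \<in> pair_image E f2 g2" and in1: "(P', Q') \<in> pair_image E f1 g1"
    using P P' sub by auto
  have "(ell_add E P P', ell_add E Q Q') \<in> pair_image E f1 g1 \<union> pair_image E f2 g2"
    using pair_image_add[OF E hom P(1) P'(1)] sub by auto
  then show False
  proof
    assume "(ell_add E P P', ell_add E Q Q') \<in> pair_image E f1 g1"
    then have "(ell_add E P' P, ell_add E Q' Q) \<in> pair_image E f1 g1"
      using ell_add_commute E curve by metis
    then show False using pair_image_diff[OF E hom1 in1] curve P(2) by blast
  next
    assume "(ell_add E P P', ell_add E Q Q') \<in> pair_image E f2 g2"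
    then show False using pair_image_diff[OF E hom2 in2] curve P'(2) by blast
  qed
qed

lemma pair_image_neg_right:
  "pair_image E f (ell_neg E \<circ> g) = map_prod id (ell_neg E) ` pair_image E f g"
  by (auto simp: pair_image_def image_image)

lemma pair_image_neg_neg: "pair_image E f (ell_neg E \<circ> (ell_neg E \<circ> g)) = pair_image E f g"
  by (auto simp: pair_image_def)

lemma pair_image_subset_quot:
  assumes E: "elliptic E" and hom: "ell_hom E f" "ell_hom E g" "ell_hom E f1" "ell_hom E g1"
    and sub: "map_prod ell_quot ell_quot ` pair_image E f g
                \<subseteq> map_prod ell_quot ell_quot ` pair_image E f1 g1"
  shows "pair_image E f g \<subseteq> pair_image E f1 g1 \<or>
         pair_image E f g \<subseteq> pair_image E f1 (ell_neg E \<circ> g1)"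
proof (rule pair_image_subset_Un)
  show "pair_image E f g \<subseteq> pair_image E f1 g1 \<union> pair_image E f1 (ell_neg E \<circ> g1)"
  proof
    fix z assume "z \<in> pair_image E f g"
    then obtain P where P: "P \<in> curve E" and z: "z = (f P, g P)"
      by (auto simp: pair_image_def)
    have "map_prod ell_quot ell_quot z \<in> map_prod ell_quot ell_quot ` pair_image E f1 g1"
      using sub \<open>z \<in> pair_image E f g\<close> by blast
    then obtain Q where Q: "Q \<in> curve E"
      and "ell_quot (f P) = ell_quot (f1 Q)" "ell_quot (g P) = ell_quot (g1 Q)"
      unfolding z by (auto simp: pair_image_def)
    then have fg: "f P = f1 Q \<or> f P = ell_neg E (f1 Q)" "g P = g1 Q \<or> g P = ell_neg E (g1 Q)"
      using P Q hom by (metis ell_quot_eq_iff ell_hom_in_curve)+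
    \<comment> \<open>The sign of the first coordinate is absorbed into the parameter.\<close>
    define Q' where "Q' = (if f P = f1 Q then Q else ell_neg E Q)"
    have "Q' \<in> curve E" using Q by (simp add: Q'_def ell_neg_in_curve)
    moreover have "f P = f1 Q'"
      using fg Q E hom by (auto simp: Q'_def ell_hom_ell_neg)
    moreover have "g P = g1 Q' \<or> g P = ell_neg E (g1 Q')"
      using fg Q E hom by (auto simp: Q'_def ell_hom_ell_neg)
    ultimately show "z \<in> pair_image E f1 g1 \<union> pair_image E f1 (ell_neg E \<circ> g1)"
      by (auto simp: z pair_image_def)
  qed
qed (use E hom ell_hom_neg ell_hom_comp in auto)

lemma pair_image_eq_quot:
  assumes E: "elliptic E" and hom: "ell_hom E f" "ell_hom E g" "ell_hom E f1" "ell_hom E g1"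
    and eq: "map_prod ell_quot ell_quot ` pair_image E f g
               = map_prod ell_quot ell_quot ` pair_image E f1 g1"
  shows "pair_image E f g = pair_image E f1 g1 \<or>
         pair_image E f g = pair_image E f1 (ell_neg E \<circ> g1)"
proof -
  \<comment> \<open>Negation of the second coordinate, an involution, is applied to both sides.\<close>
  have twist: "pair_image E h k \<subseteq> pair_image E h' (ell_neg E \<circ> k') \<Longrightarrow>
      pair_image E h (ell_neg E \<circ> k) \<subseteq> pair_image E h' k'" for h k h' k'
    using image_mono[of "pair_image E h k" "pair_image E h' (ell_neg E \<circ> k')"
        "map_prod id (ell_neg E)"]
    by (simp add: pair_image_neg_neg flip: pair_image_neg_right)
  have twist': "pair_image E h k \<subseteq> pair_image E h' k' \<Longrightarrow>
      pair_image E h (ell_neg E \<circ> k) \<subseteq> pair_image E h' (ell_neg E \<circ> k')" for h k h' k'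
    by (simp add: pair_image_neg_right image_mono)
  have "pair_image E f g \<subseteq> pair_image E f1 g1 \<or>
        pair_image E f g \<subseteq> pair_image E f1 (ell_neg E \<circ> g1)"
    using pair_image_subset_quot[OF E hom] eq by simp
  moreover have "pair_image E f1 g1 \<subseteq> pair_image E f g \<or>
        pair_image E f1 g1 \<subseteq> pair_image E f (ell_neg E \<circ> g)"
    using pair_image_subset_quot[OF E hom(3,4,1,2)] eq by simp
  ultimately show ?thesis
    using twist[of f g f1 g1] twist[of f1 g1 f g] twist'[of f g f1 g1] twist'[of f1 g1 f g]
    by blast
qed

section \<open>Iteration\<close>

lemma map_prod_funpow:
  fixes f :: "'a \<Rightarrow> 'a" and g :: "'b \<Rightarrow> 'b"
  shows "map_prod f g ^^ n = map_prod (f ^^ n) (g ^^ n)"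
  by (induction n) (auto simp: map_prod_def fun_eq_iff)

lemma map_prod_image_pair_image:
  "map_prod h k ` pair_image E f g = pair_image E (h \<circ> f) (k \<circ> g)"
  by (auto simp: pair_image_def image_image)

lemma funpow_image_Id_on_curve:
  "(map_prod f g ^^ n) ` Id_on (curve E) = pair_image E (f ^^ n) (g ^^ n)"
  by (auto simp: map_prod_funpow pair_image_def Id_on_def image_iff)

lemma map_prod_ell_quot_Id_on:
  fixes E :: "'a::alg_closed_field weierstrass"
  shows "map_prod ell_quot ell_quot ` Id_on (curve E) = Id_on UNIV"
proof -
  have "map_prod ell_quot ell_quot ` Id_on (curve E) = Id_on (ell_quot ` curve E)"
    by (auto simp: Id_on_def image_iff)
  then show ?thesis by (simp add: ell_quot_surj)
qed

lemma induced_map_funpow: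
  assumes "induced_map E f \<phi>" and "ell_hom E f" and "P \<in> curve E"
  shows "(\<phi> ^^ n) (ell_quot P) = ell_quot ((f ^^ n) P)"
proof (induction n)
  case (Suc n)
  have "(f ^^ n) P \<in> curve E"
    using assms by (simp add: ell_hom_in_curve ell_hom_funpow)
  with Suc assms(1) show ?case by (simp add: induced_map_def)
qed simp

lemma funpow_image_Id_on_proj_line:
  fixes E :: "'a::alg_closed_field weierstrass"
  assumes "ell_hom E f" "ell_hom E g" "induced_map E f \<phi>" "induced_map E g \<psi>"
  shows "(map_prod \<phi> \<psi> ^^ n) ` Id_on UNIV
           = map_prod ell_quot ell_quot ` pair_image E (f ^^ n) (g ^^ n)"
proof -
  have "(map_prod \<phi> \<psi> ^^ n) ` Id_on UNIV
      = (\<lambda>z. ((\<phi> ^^ n) z, (\<psi> ^^ n) z)) ` ell_quot ` curve E"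
    unfolding ell_quot_surj by (auto simp: map_prod_funpow Id_on_def image_iff)
  also have "\<dots> = (\<lambda>P. (ell_quot ((f ^^ n) P), ell_quot ((g ^^ n) P))) ` curve E"
    unfolding image_image using assms by (intro image_cong) (simp_all add: induced_map_funpow)
  finally show ?thesis by (simp add: pair_image_def image_image)
qed

text \<open>A period \<open>k\<close> of the diagonal of the product of projective lines gives the period \<open>k\<close> or \<open>2 k\<close>
  upstairs: \<open>2 k\<close> steps undo a change of sign of the second coordinate.\<close>

lemma pair_image_funpow_periodic:
  assumes E: "elliptic E" and f: "ell_hom E f" and g: "ell_hom E g"
    and eq: "map_prod ell_quot ell_quot ` pair_image E (f ^^ (n + k)) (g ^^ (n + k))
               = map_prod ell_quot ell_quot ` pair_image E (f ^^ n) (g ^^ n)"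
  shows "pair_image E (f ^^ (n + k)) (g ^^ (n + k)) = pair_image E (f ^^ n) (g ^^ n) \<or>
         pair_image E (f ^^ (n + 2 * k)) (g ^^ (n + 2 * k)) = pair_image E (f ^^ n) (g ^^ n)"
proof -
  define A where "A m = pair_image E (f ^^ m) (g ^^ m)" for m
  define B where "B m = pair_image E (f ^^ m) (ell_neg E \<circ> g ^^ m)" for m
  have neg_A: "B m = map_prod id (ell_neg E) ` A m" for m
    by (simp add: A_def B_def pair_image_neg_right)
  have neg_B: "A m = map_prod id (ell_neg E) ` B m" for m
    unfolding A_def B_def by (simp add: pair_image_neg_neg flip: pair_image_neg_right)
  have step_A: "A (m + k) = map_prod (f ^^ k) (g ^^ k) ` A m" for m
    by (simp add: A_def map_prod_image_pair_image add.commute[of m k] flip: funpow_add)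
  have step_B: "B (m + k) = map_prod (f ^^ k) (g ^^ k) ` B m" for m
  proof -
    have "(g ^^ k) (ell_neg E ((g ^^ m) P)) = ell_neg E ((g ^^ (k + m)) P)" if "P \<in> curve E" for P
      using that E g by (simp add: ell_hom_ell_neg ell_hom_funpow ell_hom_in_curve funpow_add)
    then show ?thesis
      unfolding B_def map_prod_image_pair_image pair_image_def
      by (simp add: image_image add.commute[of m k] funpow_add cong: image_cong)
  qed
  have "A (n + k) = A n \<or> A (n + k) = B n"
    unfolding A_def B_def
    using E eq by (intro pair_image_eq_quot ell_hom_funpow f g) auto
  moreover have "A (n + 2 * k) = A n" if "A (n + k) = B n"
  proof -
    have "A (n + 2 * k) = map_prod (f ^^ k) (g ^^ k) ` A (n + k)"
      using step_A[of "n + k"] by (simp add: mult_2 add.assoc)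
    also have "\<dots> = B (n + k)" using that step_B by simp
    also have "\<dots> = A n" using that neg_A[of "n + k"] neg_B[of n] by simp
    finally show ?thesis .
  qed
  ultimately show ?thesis by (auto simp: A_def)
qed

theorem theorem1p3:
  fixes E :: "'a::{alg_closed_field, field_char_0} weierstrass"
    and \<omega> \<omega>' :: "'a ell_point \<Rightarrow> 'a ell_point"
    and \<phi> \<phi>' :: "'a proj_line \<Rightarrow> 'a proj_line"
  assumes "elliptic E"
    and "complex_mult E"
    and "\<omega> \<in> End E" and "\<omega>' \<in> End E"
    and "induced_map E \<omega> \<phi>" and "induced_map E \<omega>' \<phi>'"
  shows "Id_on UNIV = map_prod ell_quot ell_quot ` Id_on (curve E) \<and>
     (preperiodic (curve E \<times> curve E) (map_prod \<omega> \<omega>') (Id_on (curve E)) \<longleftrightarrow>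
      preperiodic (UNIV \<times> UNIV) (map_prod \<phi> \<phi>') (Id_on UNIV))"
proof -
  have hom: "ell_hom E \<omega>" "ell_hom E \<omega>'"
    using assms End_imp_ell_hom by auto
  obtain P where "P \<in> curve E" "ell_quot P = Aff 0"
    using ell_quot_surj[of E] by (metis UNIV_I imageE)
  then have "(Infinity, P) \<in> curve E \<times> curve E - Id_on (curve E)" by auto
  then have "Id_on (curve E) \<subset> curve E \<times> curve E" by blast
  moreover have "map_prod \<omega> \<omega>' ` (curve E \<times> curve E) \<subseteq> curve E \<times> curve E"
    using hom by (auto simp: ell_hom_in_curve)
  ultimately have up: "preperiodic (curve E \<times> curve E) (map_prod \<omega> \<omega>') (Id_on (curve E)) \<longleftrightarrow>
      (\<exists>n k. k > 0 \<and> pair_image E (\<omega> ^^ (n + k)) (\<omega>' ^^ (n + k)) = pair_image E (\<omega> ^^ n) (\<omega>' ^^ n))"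
    by (simp add: preperiodic_def funpow_image_Id_on_curve)
  have "(PInf, Aff 0) \<in> UNIV \<times> UNIV - Id_on (UNIV :: 'a proj_line set)" by auto
  then have "Id_on (UNIV :: 'a proj_line set) \<subset> UNIV \<times> UNIV" by blast
  then have down: "preperiodic (UNIV \<times> UNIV) (map_prod \<phi> \<phi>') (Id_on UNIV) \<longleftrightarrow>
      (\<exists>n k. k > 0 \<and> map_prod ell_quot ell_quot ` pair_image E (\<omega> ^^ (n + k)) (\<omega>' ^^ (n + k))
                    = map_prod ell_quot ell_quot ` pair_image E (\<omega> ^^ n) (\<omega>' ^^ n))"
    using funpow_image_Id_on_proj_line[OF hom assms(5,6)] by (simp add: preperiodic_def)
  have "preperiodic (curve E \<times> curve E) (map_prod \<omega> \<omega>') (Id_on (curve E)) \<longleftrightarrow>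
      preperiodic (UNIV \<times> UNIV) (map_prod \<phi> \<phi>') (Id_on UNIV)"
    unfolding up down
  proof
    assume "\<exists>n k. k > 0 \<and>
      map_prod ell_quot ell_quot ` pair_image E (\<omega> ^^ (n + k)) (\<omega>' ^^ (n + k))
        = map_prod ell_quot ell_quot ` pair_image E (\<omega> ^^ n) (\<omega>' ^^ n)"
    then obtain n k where "k > 0" and
      eq: "map_prod ell_quot ell_quot ` pair_image E (\<omega> ^^ (n + k)) (\<omega>' ^^ (n + k))
        = map_prod ell_quot ell_quot ` pair_image E (\<omega> ^^ n) (\<omega>' ^^ n)"
      by blast
    from pair_image_funpow_periodic[OF assms(1) hom eq]
    show "\<exists>n k. k > 0 \<and>
      pair_image E (\<omega> ^^ (n + k)) (\<omega>' ^^ (n + k)) = pair_image E (\<omega> ^^ n) (\<omega>' ^^ n)"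
    proof
      assume "pair_image E (\<omega> ^^ (n + k)) (\<omega>' ^^ (n + k)) = pair_image E (\<omega> ^^ n) (\<omega>' ^^ n)"
      with \<open>k > 0\<close> show ?thesis by (intro exI[of _ n] exI[of _ k] conjI)
    next
      assume "pair_image E (\<omega> ^^ (n + 2 * k)) (\<omega>' ^^ (n + 2 * k))
        = pair_image E (\<omega> ^^ n) (\<omega>' ^^ n)"
      with \<open>k > 0\<close> show ?thesis by (intro exI[of _ n] exI[of _ "2 * k"] conjI) simp_all
    qed
  next
    assume "\<exists>n k. k > 0 \<and>
      pair_image E (\<omega> ^^ (n + k)) (\<omega>' ^^ (n + k)) = pair_image E (\<omega> ^^ n) (\<omega>' ^^ n)"
    then obtain n k where "k > 0" and
      eq: "pair_image E (\<omega> ^^ (n + k)) (\<omega>' ^^ (n + k)) = pair_image E (\<omega> ^^ n) (\<omega>' ^^ n)"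
      by blast
    show "\<exists>n k. k > 0 \<and>
      map_prod ell_quot ell_quot ` pair_image E (\<omega> ^^ (n + k)) (\<omega>' ^^ (n + k))
        = map_prod ell_quot ell_quot ` pair_image E (\<omega> ^^ n) (\<omega>' ^^ n)"
      using \<open>k > 0\<close> arg_cong[OF eq, of "image (map_prod ell_quot ell_quot)"]
      by (intro exI[of _ n] exI[of _ k] conjI)
  qed
  then show ?thesis by (simp add: map_prod_ell_quot_Id_on)
qed

end
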